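(* Let $H$ be a Hilbert space, $\Omega\subseteq H$ a nonempty open set, $F:\Omega\to H$ a continuous function with continuous Fréchet derivative $F'$, $T:H\rightrightarrows H$ a set-valued maximal monotone operator and $x^*\in\Omega$. Suppose that $0\in F(x^* )+T(x^* )$, that $F'(x^* )$ is a positive operator, that $\widehat{F'(x^* )}^{-1}$ exists, and that there exists a constant $K>0$ such that $$\|\widehat{F'(x^* )}^{-1}\|\,\|F'(x)-F'(y)\|\le K\|x-y\|,\qquad x,y\in\Omega.$$ Let $r:=\min\{\kappa,2/(3K)\}$, where $\kappa:=\sup\{t>0: B(x^*,t)\subset\Omega\}$. Then the sequences with starting point $x_0\in B(x^*,r)\setminus\{x^*\}$ and $t_0=\|x^*-x_0\|$, given respectively by $$F(x_k)+F'(x_k)(x_{k+1}-x_k)+T(x_{k+1})\ni 0,\qquad t_{k+1}=\frac{(K/2)\,t_k^2}{1-Kt_k},\qquad k=0,1,\ldots,$$ are well defined; $\{t_k\}$ is strictly decreasing, is contained in $(0,r)$ and converges to $0$; $\{x_k\}$ is contained in $B(x^*,r)$ and converges to the point $x^*$, which is the unique solution of $F(x)+T(x)\ni 0$ in $B(x^*,\bar\sigma)$, where $\bar\sigma=\min\{r,2/K\}$. Moreover, $\{t_{k+1}/t_k^2\}$ is strictly decreasing, and for $k=0,1,\ldots$, $$\frac{t_{k+1}}{t_k^2}<\frac{1}{2/K-2\|x^*-x_0\|}$$ and $$\|x^*-x_{k+1}\|\le\frac K2\,\frac1{1-Kt_k}\,\|x_k-x^*\|^2\le\frac K2\,\frac1{1-K\|x_0-x^*\|}\,\|x_k-x^*\|^2.$$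 If, additionally, $2/(3K)<\kappa$, then $r=2/(3K)$ is the best possible convergence radius.
   Context: $B(x,\delta)$ denotes the open ball with centre $x$ and radius $\delta$. A bounded linear operator $G:H\to H$ is called positive if it is self-conjugate (self-adjoint) and $\langle Gx,x\rangle\ge 0$ for all $x\in H$. For a bounded linear operator $G:H\to H$ with conjugate (adjoint) operator $G^*$, $\widehat G:=\frac12(G+G^* )$; norms of operators are operator norms. A set-valued operator $T:H\rightrightarrows H$ with $\mathrm{dom}\,T=\{x\in H: T(x)\ne\varnothing\}$ is monotone if $\langle u-v,y-x\rangle\ge 0$ whenever $x,y\in\mathrm{dom}\,T$, $u\in T(y)$ and $v\in T(x)$; it is maximal monotone if it is monotone and, whenever $x,u\in H$ satisfy $\langle u-v,x-y\rangle\ge0$ for all $y\in\mathrm{dom}\,T$ and $v\in T(y)$, then $x\in\mathrm{dom}\,T$ and $u\in T(x)$. The sequence $\{x_k\}$ is the Newton sequence for the generalized equation $F(x)+T(x)\ni0$.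
   Formalization: The strict bound t_{k+1}/t_k^2 < 1/(2/K - 2||x*-x_0||) is false at k=0, where equality always holds since t_0 = ||x*-x_0||; it is stated and proved as "≤" for all k ≥ 0 and as strict "<" for all k ≥ 1. *)

theory Defs
  imports "HOL-Analysis.Analysis" "HOL-Library.Set_Algebras"
begin

text \<open>
  Hilbert spaces are real; they are types of class \<open>{real_inner, complete_space}\<close>.
  Bounded operators are elements of \<open>'a \<Rightarrow>\<^sub>L 'a\<close>, so \<open>norm\<close> is the operator norm.
\<close>

definition adjoint_op :: "('a::{real_inner,complete_space} \<Rightarrow>\<^sub>L 'a) \<Rightarrow> ('a \<Rightarrow>\<^sub>L 'a)" where
  "adjoint_op G = Blinfun (adjoint (blinfun_apply G))"

definition positive_op :: "('a::{real_inner,complete_space} \<Rightarrow>\<^sub>L 'a) \<Rightarrow> bool" where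
  "positive_op G \<longleftrightarrow> adjoint_op G = G \<and> (\<forall>x. 0 \<le> blinfun_apply G x \<bullet> x)"

definition sym_part :: "('a::{real_inner,complete_space} \<Rightarrow>\<^sub>L 'a) \<Rightarrow> ('a \<Rightarrow>\<^sub>L 'a)" where
  "sym_part G = (1/2) *\<^sub>R (G + adjoint_op G)"

definition is_inverse_op :: "('a::real_normed_vector \<Rightarrow>\<^sub>L 'a) \<Rightarrow> ('a \<Rightarrow>\<^sub>L 'a) \<Rightarrow> bool" where
  "is_inverse_op G J \<longleftrightarrow> J o\<^sub>L G = id_blinfun \<and> G o\<^sub>L J = id_blinfun"

definition invertible_op :: "('a::real_normed_vector \<Rightarrow>\<^sub>L 'a) \<Rightarrow> bool" where
  "invertible_op G \<longleftrightarrow> (\<exists>J. is_inverse_op G J)"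

definition inverse_op :: "('a::real_normed_vector \<Rightarrow>\<^sub>L 'a) \<Rightarrow> ('a \<Rightarrow>\<^sub>L 'a)" where
  "inverse_op G = (THE J. is_inverse_op G J)"

definition set_dom :: "('a \<Rightarrow> 'b set) \<Rightarrow> 'a set" where
  "set_dom T = {x. T x \<noteq> {}}"

definition monotone_op :: "('a::real_inner \<Rightarrow> 'a set) \<Rightarrow> bool" where
  "monotone_op T \<longleftrightarrow>
     (\<forall>x\<in>set_dom T. \<forall>y\<in>set_dom T. \<forall>u\<in>T y. \<forall>v\<in>T x. 0 \<le> (u - v) \<bullet> (y - x))"

definition maximal_monotone_op :: "('a::real_inner \<Rightarrow> 'a set) \<Rightarrow> bool" where
  "maximal_monotone_op T \<longleftrightarrow> monotone_op T \<and>
     (\<forall>x u. (\<forall>y\<in>set_dom T. \<forall>v\<in>T y. 0 \<le> (u - v) \<bullet> (x - y)) \<longrightarrow> x \<in> set_dom T \<and> u \<in> T x)"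

text \<open>
  Hypotheses on the data of the generalized equation \<open>0 \<in> F x + T x\<close>. The map \<open>F\<close> is total
  in HOL, but only its values on \<open>\<Omega>\<close> are constrained; \<open>F'\<close> is its derivative there.
\<close>

definition newton_problem ::
  "'a::{real_inner,complete_space} set \<Rightarrow> ('a \<Rightarrow> 'a) \<Rightarrow> ('a \<Rightarrow> 'a \<Rightarrow>\<^sub>L 'a) \<Rightarrow> ('a \<Rightarrow> 'a set)
     \<Rightarrow> 'a \<Rightarrow> real \<Rightarrow> bool" where
  "newton_problem \<Omega> F F' T xs K \<longleftrightarrow>
     open \<Omega> \<and> \<Omega> \<noteq> {} \<and> xs \<in> \<Omega> \<and>
     continuous_on \<Omega> F \<and>
     (\<forall>x\<in>\<Omega>. (F has_derivative blinfun_apply (F' x)) (at x)) \<and>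
     continuous_on \<Omega> F' \<and>
     maximal_monotone_op T \<and>
     0 \<in> F xs +o T xs \<and>
     positive_op (F' xs) \<and>
     invertible_op (sym_part (F' xs)) \<and>
     0 < K \<and>
     (\<forall>x\<in>\<Omega>. \<forall>y\<in>\<Omega>.
        norm (inverse_op (sym_part (F' xs))) * norm (F' x - F' y) \<le> K * norm (x - y))"

text \<open>The supremum is extended-real valued: it is \<open>\<infinity>\<close> when \<open>\<Omega>\<close> is the whole space.\<close>

definition ball_radius :: "'a::metric_space set \<Rightarrow> 'a \<Rightarrow> ereal" where
  "ball_radius \<Omega> xs = Sup (ereal ` {t. 0 < t \<and> ball xs t \<subseteq> \<Omega>})"

definition newton_radius :: "'a::metric_space set \<Rightarrow> 'a \<Rightarrow> real \<Rightarrow> real" where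
  "newton_radius \<Omega> xs K = real_of_ereal (min (ball_radius \<Omega> xs) (ereal (2 / (3 * K))))"

text \<open>
  \<open>x\<close> is a well-defined Newton sequence from \<open>x0\<close>: every iterate lies in the domain of \<open>F\<close>,
  and the next iterate is the one and only solution of the linearized inclusion.
\<close>

definition newton_sequence ::
  "'a::{real_inner,complete_space} set \<Rightarrow> ('a \<Rightarrow> 'a) \<Rightarrow> ('a \<Rightarrow> 'a \<Rightarrow>\<^sub>L 'a) \<Rightarrow> ('a \<Rightarrow> 'a set)
     \<Rightarrow> 'a \<Rightarrow> (nat \<Rightarrow> 'a) \<Rightarrow> bool" where
  "newton_sequence \<Omega> F F' T x0 x \<longleftrightarrow>
     x 0 = x0 \<and>
     (\<forall>k. x k \<in> \<Omega> \<and>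
       (\<forall>y. 0 \<in> (F (x k) + blinfun_apply (F' (x k)) (y - x k)) +o T y \<longleftrightarrow> y = x (Suc k)))"

primrec scalar_newton :: "real \<Rightarrow> real \<Rightarrow> nat \<Rightarrow> real" where
  "scalar_newton K t0 0 = t0"
| "scalar_newton K t0 (Suc k) =
     (K / 2) * (scalar_newton K t0 k)\<^sup>2 / (1 - K * scalar_newton K t0 k)"

text \<open>
  A radius is a convergence radius for \<open>\<Omega>\<close>, \<open>xs\<close>, \<open>K\<close> if it works for all \<open>F\<close> and \<open>T\<close>
  satisfying the hypotheses with these data; the best possible one is the largest of them.
\<close>

definition convergence_radius ::
  "'a::{real_inner,complete_space} set \<Rightarrow> 'a \<Rightarrow> real \<Rightarrow> real \<Rightarrow> bool" where
  "convergence_radius \<Omega> xs K \<rho> \<longleftrightarrow>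
     (\<forall>F F' T. newton_problem \<Omega> F F' T xs K \<longrightarrow>
       (\<forall>x0 \<in> ball xs \<rho> - {xs}. \<exists>x. newton_sequence \<Omega> F F' T x0 x \<and> x \<longlonglongrightarrow> xs))"

definition best_convergence_radius ::
  "'a::{real_inner,complete_space} set \<Rightarrow> 'a \<Rightarrow> real \<Rightarrow> real \<Rightarrow> bool" where
  "best_convergence_radius \<Omega> xs K r \<longleftrightarrow>
     convergence_radius \<Omega> xs K r \<and> (\<forall>\<rho>. convergence_radius \<Omega> xs K \<rho> \<longrightarrow> \<rho> \<le> r)"

text \<open>
  The library's \<open>adjoint\<close> and \<open>Blinfun\<close> are total, with unspecified values where no adjoint
  exists. The Riesz representation theorem shows that this does not happen here.
\<close>

lemma riesz_representation:
  fixes f :: "'a::{real_inner,complete_space} \<Rightarrow>\<^sub>L real"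
  shows "\<exists>z. \<forall>x. blinfun_apply f x = x \<bullet> z"
proof -
  define \<phi> where "\<phi> y = y \<bullet> y - 2 * blinfun_apply f y" for y
  have lower: "- (norm f)\<^sup>2 \<le> \<phi> y" for y
  proof -
    have "blinfun_apply f y \<le> norm f * norm y"
      using norm_blinfun[of f y] by simp
    moreover have "0 \<le> (norm y)\<^sup>2 + (norm f)\<^sup>2 - 2 * (norm f * norm y)"
      using zero_le_power2[of "norm y - norm f"] by (simp add: power2_diff mult_ac)
    ultimately show ?thesis
      unfolding \<phi>_def dot_square_norm by linarith
  qed
  define m where "m = Inf (range \<phi>)"
  have bdd: "bdd_below (range \<phi>)" unfolding bdd_below_def using lower by blast
  have m_le: "m \<le> \<phi> y" for y
    unfolding m_def by (rule cInf_lower[OF _ bdd]) auto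
  have "\<exists>y. \<phi> y < m + inverse (real (Suc n))" for n
    using cInf_lessD[of "range \<phi>" "m + inverse (real (Suc n))"] by (auto simp: m_def)
  then obtain y where y: "\<And>n. \<phi> (y n) < m + inverse (real (Suc n))" by metis
  have para: "\<phi> a + \<phi> b - 2 * \<phi> ((1/2) *\<^sub>R (a + b)) = (norm (a - b))\<^sup>2 / 2" for a b
    unfolding \<phi>_def power2_norm_eq_inner
    by (simp add: blinfun.bilinear_simps inner_add_left inner_add_right inner_diff_left
        inner_diff_right inner_commute field_simps)
  have close: "(norm (a - b))\<^sup>2 < 4 * e" if "\<phi> a < m + e" "\<phi> b < m + e" for a b e
    using para[of a b] m_le[of "(1/2) *\<^sub>R (a + b)"] that by simp
  have "Cauchy y"
  proof (rule CauchyI)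
    fix e :: real assume e: "0 < e"
    then obtain N where N: "inverse (real (Suc N)) < e\<^sup>2 / 4"
      using reals_Archimedean[of "e\<^sup>2 / 4"] by auto
    have b: "\<phi> (y n) < m + e\<^sup>2 / 4" if "N \<le> n" for n
    proof -
      have "inverse (real (Suc n)) \<le> inverse (real (Suc N))" using that by simp
      then show ?thesis using y[of n] N by linarith
    qed
    have "norm (y p - y q) < e" if "N \<le> p" "N \<le> q" for p q
    proof -
      have "(norm (y p - y q))\<^sup>2 < e\<^sup>2"
        using close[OF b[OF that(1)] b[OF that(2)]] by simp
      then show ?thesis using e by (simp add: power_less_imp_less_base)
    qed
    then show "\<exists>M. \<forall>p\<ge>M. \<forall>q\<ge>M. norm (y p - y q) < e" by blast
  qed
  then obtain z where z: "y \<longlonglongrightarrow> z"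
    using Cauchy_convergent convergent_def by blast
  have "(\<lambda>n. \<phi> (y n)) \<longlonglongrightarrow> \<phi> z"
    unfolding \<phi>_def by (intro tendsto_intros z)
  moreover have "(\<lambda>n. m + inverse (real (Suc n))) \<longlonglongrightarrow> m + 0"
    by (intro tendsto_intros LIMSEQ_inverse_real_of_nat)
  ultimately have z_le: "\<phi> z \<le> m"
    using LIMSEQ_le[of "\<lambda>n. \<phi> (y n)" "\<phi> z" "\<lambda>n. m + inverse (real (Suc n))" m] y
    by (auto intro: less_imp_le)
  have "blinfun_apply f x = x \<bullet> z" for x
  proof -
    define c where "c = blinfun_apply f x - x \<bullet> z"
    have quad: "0 \<le> s\<^sup>2 * (x \<bullet> x) - 2 * s * c" for s
    proof -
      have "\<phi> (z + s *\<^sub>R x) - \<phi> z = s\<^sup>2 * (x \<bullet> x) - 2 * s * c"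
        unfolding \<phi>_def c_def
        by (simp add: blinfun.bilinear_simps inner_add_left inner_add_right
            inner_commute power2_eq_square algebra_simps)
      then show ?thesis using z_le m_le[of "z + s *\<^sub>R x"] by linarith
    qed
    have "c = 0"
    proof (rule ccontr)
      assume c: "c \<noteq> 0"
      define s where "s = c / (1 + x \<bullet> x)"
      have pos: "0 < 1 + x \<bullet> x" by (simp add: add_pos_nonneg)
      have sc: "s * (1 + x \<bullet> x) = c" using less_imp_neq[OF pos] unfolding s_def by simp
      then have "s \<noteq> 0" using c by auto
      have "s\<^sup>2 * (x \<bullet> x) - 2 * s * c = s\<^sup>2 * (x \<bullet> x) - 2 * s * (s * (1 + x \<bullet> x))"
        unfolding sc ..
      also have "\<dots> = - (s\<^sup>2 * (2 + x \<bullet> x))" by (simp add: power2_eq_square algebra_simps)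
      also have "\<dots> < 0"
        using \<open>s \<noteq> 0\<close> pos by (simp add: zero_less_mult_iff)
      finally show False using quad[of s] by linarith
    qed
    then show ?thesis by (simp add: c_def)
  qed
  then show ?thesis by blast
qed

lemma inner_adjoint_op:
  fixes G :: "'a::{real_inner,complete_space} \<Rightarrow>\<^sub>L 'a"
  shows "blinfun_apply G x \<bullet> y = x \<bullet> blinfun_apply (adjoint_op G) y"
proof -
  have "\<exists>z. \<forall>x. blinfun_apply G x \<bullet> y = x \<bullet> z" for y
  proof -
    have "bounded_linear (\<lambda>x. blinfun_apply G x \<bullet> y)"
      by (intro bounded_linear_intros)
    then show ?thesis
      using riesz_representation[of "Blinfun (\<lambda>x. blinfun_apply G x \<bullet> y)"]
      by (simp add: bounded_linear_Blinfun_apply)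
  qed
  then obtain g where g: "\<And>x y. blinfun_apply G x \<bullet> y = x \<bullet> g y" by metis
  have ag: "adjoint (blinfun_apply G) = g" by (rule adjoint_unique) (simp add: g)
  have "bounded_linear g"
  proof (rule bounded_linear_intro)
    fix a b :: 'a and r :: real
    have "x \<bullet> g (a + b) = x \<bullet> (g a + g b)" for x by (simp add: g[symmetric] inner_add_right)
    then show "g (a + b) = g a + g b" by (metis vector_eq_rdot inner_commute)
    have "x \<bullet> g (r *\<^sub>R a) = x \<bullet> (r *\<^sub>R g a)" for x by (simp add: g[symmetric])
    then show "g (r *\<^sub>R a) = r *\<^sub>R g a" by (metis vector_eq_rdot inner_commute)
    have "(norm (g a))\<^sup>2 = blinfun_apply G (g a) \<bullet> a" by (simp add: g power2_norm_eq_inner)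
    also have "\<dots> \<le> norm (blinfun_apply G (g a)) * norm a" by (rule norm_cauchy_schwarz)
    also have "\<dots> \<le> norm G * norm (g a) * norm a"
      by (intro mult_right_mono norm_blinfun) simp
    finally have "norm (g a) * norm (g a) \<le> (norm a * norm G) * norm (g a)"
      by (simp add: power2_eq_square mult_ac)
    then show "norm (g a) \<le> norm a * norm G"
      by (cases "norm (g a) = 0") (simp_all add: mult_le_cancel_right)
  qed
  then show ?thesis by (simp add: adjoint_op_def ag bounded_linear_Blinfun_apply g)
qed

lemma inverse_op_eq:
  assumes "is_inverse_op G J"
  shows "inverse_op G = J"
  unfolding inverse_op_def
proof (rule the_equality)
  show "is_inverse_op G J" by (rule assms)
next
  fix L assume "is_inverse_op G L"
  then have "blinfun_apply L (blinfun_apply G (blinfun_apply J x)) = blinfun_apply J x" for x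
    unfolding is_inverse_op_def by (metis blinfun_apply_blinfun_compose blinfun_apply_id_blinfun id_apply)
  then show "L = J"
    using assms unfolding is_inverse_op_def
    by (metis blinfun_apply_blinfun_compose blinfun_apply_id_blinfun blinfun_eqI id_apply)
qed

end

theory Submission
  imports Defs
begin

text \<open>
  Write \<open>\<beta>\<close> for the norm of the inverse of \<open>F' xs\<close>. Positivity gives \<open>\<langle>F' xs h, h\<rangle> \<ge> \<parallel>h\<parallel>\<^sup>2 / \<beta>\<close>,
  and the Lipschitz condition turns this into strong monotonicity of \<open>F' x\<close>, with constant
  \<open>(1 - K \<parallel>x - xs\<parallel>) / \<beta>\<close>, for \<open>x\<close> near \<open>xs\<close>. By Minty's theorem the linearized inclusion then has
  exactly one solution, and testing it against the inclusion at \<open>xs\<close> gives the quadratic error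
  bound, which the scalar sequence majorizes.

  Minty's theorem is obtained without weak compactness: adding half the squared norm to the
  Fitzpatrick function makes it strongly convex, so minimizing sequences are Cauchy.
\<close>

section \<open>Minty's theorem\<close>

text \<open>Think of \<open>C\<close> as the epigraph of a convex function: \<open>z\<close>
  minimizes that function plus half the squared norm, and first-order optimality makes
  \<open>- z\<close> a subgradient there. Working with the set \<open>C\<close> avoids a function
  with infinite values.\<close>

lemma subgradient_at_minimum:
  fixes C :: "('b::{real_inner,complete_space} \<times> real) set"
  assumes "closed C" "convex C" "C \<noteq> {}"
    and lower: "\<And>z s. (z, s) \<in> C \<Longrightarrow> b \<le> s + (norm z)\<^sup>2 / 2"
  obtains z s where "(z, s) \<in> C" "\<And>z' s'. (z', s') \<in> C \<Longrightarrow> s \<le> s' + z \<bullet> (z' - z)"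
proof -
  define h where "h p = snd p + fst p \<bullet> fst p / 2" for p :: "'b \<times> real"
  define m where "m = Inf (h ` C)"
  have bdd: "bdd_below (h ` C)"
    using lower unfolding bdd_below_def h_def by (fastforce simp: power2_norm_eq_inner)
  have m_le: "m \<le> h p" if "p \<in> C" for p
    unfolding m_def using that by (intro cInf_lower[OF _ bdd]) auto
  have "\<exists>p\<in>C. h p < m + inverse (real (Suc n))" for n
    using cInf_lessD[of "h ` C" "m + inverse (real (Suc n))"] assms(3) by (auto simp: m_def)
  then obtain p where pC: "\<And>n. p n \<in> C" and p: "\<And>n. h (p n) < m + inverse (real (Suc n))"
    by metis
  \<comment> \<open>The second component is linear and cancels, leaving the parallelogram identity.
    Near-minimizers thus have close first components, because their midpoint cannot go below
    \<open>m\<close>.\<close>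
  have para: "h a + h b - 2 * h ((1/2) *\<^sub>R a + (1/2) *\<^sub>R b) = (norm (fst a - fst b))\<^sup>2 / 4" for a b
    unfolding h_def power2_norm_eq_inner
    by (simp add: inner_add_left inner_add_right inner_diff_left
        inner_diff_right inner_commute field_simps)
  have close: "(norm (fst a - fst b))\<^sup>2 < 8 * e"
    if "h a < m + e" "h b < m + e" "a \<in> C" "b \<in> C" for a b e
  proof -
    have "(1/2) *\<^sub>R a + (1/2) *\<^sub>R b \<in> C"
      using convexD[OF assms(2) that(3,4), of "1/2" "1/2"] by simp
    from m_le[OF this] show ?thesis using para[of a b] that(1,2) by simp
  qed
  have "Cauchy (\<lambda>n. fst (p n))"
  proof (rule CauchyI)
    fix e :: real assume e: "0 < e"
    then obtain N where N: "inverse (real (Suc N)) < e\<^sup>2 / 8"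
      using reals_Archimedean[of "e\<^sup>2 / 8"] by auto
    have b: "h (p n) < m + e\<^sup>2 / 8" if "N \<le> n" for n
    proof -
      have "inverse (real (Suc n)) \<le> inverse (real (Suc N))" using that by simp
      then show ?thesis using p[of n] N by linarith
    qed
    have "norm (fst (p i) - fst (p j)) < e" if "N \<le> i" "N \<le> j" for i j
    proof -
      have "(norm (fst (p i) - fst (p j)))\<^sup>2 < e\<^sup>2"
        using close[OF b[OF that(1)] b[OF that(2)] pC pC] by simp
      then show ?thesis using e by (simp add: power_less_imp_less_base)
    qed
    then show "\<exists>M. \<forall>i\<ge>M. \<forall>j\<ge>M. norm (fst (p i) - fst (p j)) < e" by blast
  qed
  then obtain z where z: "(\<lambda>n. fst (p n)) \<longlonglongrightarrow> z"
    using Cauchy_convergent convergent_def by blast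
  have hlim: "(\<lambda>n. h (p n)) \<longlonglongrightarrow> m"
  proof (rule tendsto_sandwich[OF _ _ tendsto_const])
    show "(\<lambda>n. m + inverse (real (Suc n))) \<longlonglongrightarrow> m"
      using tendsto_add[OF tendsto_const LIMSEQ_inverse_real_of_nat, of m] by simp
  qed (use p m_le pC in \<open>auto intro!: eventuallyI less_imp_le\<close>)
  \<comment> \<open>Only the first components are known to be Cauchy. The second ones converge
    because \<open>h (p n)\<close> does, and this is their limit.\<close>
  define s where "s = m - z \<bullet> z / 2"
  have "(\<lambda>n. h (p n) - fst (p n) \<bullet> fst (p n) / 2) \<longlonglongrightarrow> s"
    unfolding s_def by (intro tendsto_intros hlim z) auto
  then have "(\<lambda>n. snd (p n)) \<longlonglongrightarrow> s" by (simp add: h_def)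
  then have "(\<lambda>n. (fst (p n), snd (p n))) \<longlonglongrightarrow> (z, s)" by (intro tendsto_Pair z)
  then have zs: "(z, s) \<in> C"
    using assms(1) pC by (auto simp: closed_sequential_limits)
  have "s \<le> s' + z \<bullet> (z' - z)" if C: "(z', s') \<in> C" for z' s'
  proof (rule ccontr)
    define c where "c = s - s' - z \<bullet> (z' - z)"
    define d where "d = (z' - z) \<bullet> (z' - z)"
    assume "\<not> ?thesis"
    then have c: "0 < c" by (simp add: c_def)
    have d: "0 \<le> d" by (simp add: d_def)
    \<comment> \<open>On the segment towards \<open>(z', s')\<close> the value of \<open>h\<close>
      is \<open>m - \<tau> c + \<tau>^2 d / 2\<close>. This choice gives
      \<open>\<tau> \<le> 1\<close> and \<open>\<tau> d < c\<close>, so the linear decrease wins; it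
      also covers \<open>d = 0\<close>.\<close>
    define \<tau> where "\<tau> = c / (c + d)"
    have \<tau>: "0 < \<tau>" "\<tau> \<le> 1" "\<tau> * (c + d) = c" using c d by (auto simp: \<tau>_def field_simps)
    have "(1 - \<tau>) *\<^sub>R (z, s) + \<tau> *\<^sub>R (z', s') \<in> C"
      using convexD[OF assms(2) zs C, of "1 - \<tau>" \<tau>] \<tau> by simp
    from m_le[OF this] have "m \<le> h ((1 - \<tau>) *\<^sub>R (z, s) + \<tau> *\<^sub>R (z', s'))" .
    also have "\<dots> = m - \<tau> * c + \<tau>\<^sup>2 * d / 2"
      unfolding h_def c_def d_def s_def
      by (simp add: inner_add_left inner_add_right inner_diff_left inner_diff_right
          inner_commute[of z' z] power2_eq_square field_simps)
    finally have "\<tau> * c \<le> \<tau> * (\<tau> * d / 2)" by (simp add: power2_eq_square)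
    then have "c \<le> \<tau> * d / 2" using \<tau>(1) by (simp add: mult_le_cancel_left)
    moreover have "\<tau> * d = c - \<tau> * c" using \<tau>(3) by (simp add: algebra_simps)
    moreover have "0 < \<tau> * c" using \<tau> c by simp
    ultimately show False using c by linarith
  qed
  then show thesis using zs that by blast
qed

lemma monotone_opD:
  assumes "monotone_op T" "u \<in> T x" "v \<in> T y"
  shows "0 \<le> (u - v) \<bullet> (x - y)"
  using assms unfolding monotone_op_def set_dom_def by blast

lemma maximal_monotone_op_monotone: "maximal_monotone_op T \<Longrightarrow> monotone_op T"
  by (simp add: maximal_monotone_op_def)

lemma maximal_monotone_opD:
  assumes "maximal_monotone_op T" "\<And>y v. v \<in> T y \<Longrightarrow> 0 \<le> (u - v) \<bullet> (x - y)"
  shows "u \<in> T x"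
  using assms unfolding maximal_monotone_op_def by blast

text \<open>For an empty graph the maximality test is vacuous and would put \<open>0\<close> into
  \<open>T 0\<close>.\<close>

lemma maximal_monotone_op_nonempty:
  assumes "maximal_monotone_op T"
  obtains x u where "u \<in> T x"
proof -
  have "0 \<in> T 0" if "\<And>x u. u \<notin> T x"
    by (rule maximal_monotone_opD[OF assms]) (use that in blast)
  then show thesis using that by blast
qed

text \<open>Since \<open>w - x \<in> l T x\<close> means \<open>- x \<in> l T x - w\<close>, the
  point \<open>w\<close> and the step \<open>l\<close> can be absorbed into the operator, which
  reduces the resolvent to the inclusion \<open>- x \<in> T x\<close>.\<close>

lemma maximal_monotone_op_affine:
  assumes T: "maximal_monotone_op T" and "0 < \<alpha>"
  shows "maximal_monotone_op (\<lambda>x. (\<lambda>v. \<alpha> *\<^sub>R v + b) ` T x)" (is "maximal_monotone_op ?S")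
  unfolding maximal_monotone_op_def
proof (intro conjI allI impI)
  show "monotone_op ?S"
    using monotone_opD[OF maximal_monotone_op_monotone[OF T]] assms(2)
    unfolding monotone_op_def set_dom_def
    by (auto simp: scaleR_diff_right[symmetric])
next
  fix x u assume *: "\<forall>y\<in>set_dom ?S. \<forall>v\<in>?S y. 0 \<le> (u - v) \<bullet> (x - y)"
  have "(1 / \<alpha>) *\<^sub>R (u - b) \<in> T x"
  proof (rule maximal_monotone_opD[OF T])
    fix y v assume "v \<in> T y"
    with * have "0 \<le> (u - (\<alpha> *\<^sub>R v + b)) \<bullet> (x - y)" unfolding set_dom_def by blast
    also have "u - (\<alpha> *\<^sub>R v + b) = \<alpha> *\<^sub>R ((1 / \<alpha>) *\<^sub>R (u - b) - v)"
      using assms(2) by (simp add: algebra_simps)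
    finally show "0 \<le> ((1 / \<alpha>) *\<^sub>R (u - b) - v) \<bullet> (x - y)"
      using assms(2) by (simp add: zero_le_mult_iff)
  qed
  then have "u \<in> ?S x" using assms(2) by (intro image_eqI[of _ _ "(1 / \<alpha>) *\<^sub>R (u - b)"]) auto
  then show "x \<in> set_dom ?S" "u \<in> ?S x" unfolding set_dom_def by blast+
qed

text \<open>
  The set \<open>C\<close> is the epigraph of the Fitzpatrick function of \<open>T\<close>, which lies above the duality
  pairing and agrees with it on the graph of \<open>T\<close>.
\<close>

lemma minty_zero:
  fixes T :: "'a::{real_inner,complete_space} \<Rightarrow> 'a set"
  assumes T: "maximal_monotone_op T"
  obtains x where "- x \<in> T x"
proof -
  define C where "C = {p. \<forall>y v. v \<in> T y \<longrightarrow>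
    fst (fst p) \<bullet> v + y \<bullet> snd (fst p) - y \<bullet> v \<le> (snd p :: real)}"
  have "C = (\<Inter>y. \<Inter>v\<in>T y. {p. fst (fst p) \<bullet> v + y \<bullet> snd (fst p) - y \<bullet> v \<le> snd p})"
    unfolding C_def by auto
  also have "closed \<dots>"
    by (intro closed_INT ballI closed_Collect_le continuous_intros)
  finally have "closed C" .
  have "convex C"
  proof (rule convexI)
    fix p q and \<mu> \<nu> :: real
    assume *: "p \<in> C" "q \<in> C" "0 \<le> \<mu>" "0 \<le> \<nu>" "\<mu> + \<nu> = 1"
    show "\<mu> *\<^sub>R p + \<nu> *\<^sub>R q \<in> C"
      unfolding C_def
    proof (intro CollectI allI impI)
      fix y v assume v: "v \<in> T y"
      have "\<mu> * (fst (fst p) \<bullet> v + y \<bullet> snd (fst p) - y \<bullet> v) \<le> \<mu> * snd p"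
        "\<nu> * (fst (fst q) \<bullet> v + y \<bullet> snd (fst q) - y \<bullet> v) \<le> \<nu> * snd q"
        using * v by (auto simp: C_def intro!: mult_left_mono)
      moreover have "y \<bullet> v = \<mu> * (y \<bullet> v) + \<nu> * (y \<bullet> v)"
        using *(5) by (simp add: distrib_right[symmetric])
      ultimately show "fst (fst (\<mu> *\<^sub>R p + \<nu> *\<^sub>R q)) \<bullet> v + y \<bullet> snd (fst (\<mu> *\<^sub>R p + \<nu> *\<^sub>R q)) - y \<bullet> v
          \<le> snd (\<mu> *\<^sub>R p + \<nu> *\<^sub>R q)"
        by (simp add: inner_add_left inner_add_right algebra_simps)
    qed
  qed
  have graph: "((y, v), y \<bullet> v) \<in> C" if "v \<in> T y" for y v
    unfolding C_def
  proof (intro CollectI allI impI)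
    fix y' v' assume "v' \<in> T y'"
    from monotone_opD[OF maximal_monotone_op_monotone[OF T] that this]
    show "fst (fst ((y, v), y \<bullet> v)) \<bullet> v' + y' \<bullet> snd (fst ((y, v), y \<bullet> v)) - y' \<bullet> v'
        \<le> snd ((y, v), y \<bullet> v)"
      by (simp add: inner_diff_left inner_diff_right inner_commute)
  qed
  then have "C \<noteq> {}" using maximal_monotone_op_nonempty[OF T] by blast
  \<comment> \<open>Monotonicity gave the upper bound on the graph; this lower bound is maximality.
    If it failed at \<open>(x, u)\<close>, maximality would give \<open>u \<in> T x\<close>, and the
    strict bound \<open>**\<close> at that very pair is absurd.\<close>
  have above: "x \<bullet> u \<le> s" if C: "((x, u), s) \<in> C" for x u s
  proof (rule ccontr)
    assume "\<not> x \<bullet> u \<le> s"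
    have **: "x \<bullet> v + y \<bullet> u - y \<bullet> v < x \<bullet> u" if "v \<in> T y" for y v
      using C that \<open>\<not> x \<bullet> u \<le> s\<close> by (fastforce simp: C_def)
    have "u \<in> T x"
    proof (rule maximal_monotone_opD[OF T])
      fix y v assume "v \<in> T y"
      from **[OF this] show "0 \<le> (u - v) \<bullet> (x - y)"
        by (simp add: inner_diff_left inner_diff_right inner_commute)
    qed
    from **[OF this] show False by (simp add: inner_commute)
  qed
  \<comment> \<open>By \<open>above\<close>, the minimized quantity is at least half of
    \<open>\<parallel>x + u\<parallel>^2\<close>.\<close>
  have "0 \<le> s + (norm z)\<^sup>2 / 2" if "(z, s) \<in> C" for z s
  proof -
    obtain x u where z: "z = (x, u)" by (cases z)
    have "0 \<le> (x + u) \<bullet> (x + u)" by simp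
    also have "\<dots> = (norm z)\<^sup>2 + 2 * (x \<bullet> u)"
      unfolding z power2_norm_eq_inner by (simp add: inner_add_left inner_add_right inner_commute)
    finally show ?thesis using above[of x u s] that unfolding z by linarith
  qed
  from subgradient_at_minimum[OF \<open>closed C\<close> \<open>convex C\<close> \<open>C \<noteq> {}\<close> this]
  obtain z s where zs: "(z, s) \<in> C" "\<And>z' s'. (z', s') \<in> C \<Longrightarrow> s \<le> s' + z \<bullet> (z' - z)" by metis
  obtain x u where z: "z = (x, u)" by (cases z)
  \<comment> \<open>This is the subgradient inequality at a graph point combined with
    \<open>x \<bullet> u \<le> s\<close>. It shows that \<open>(- u, - x)\<close> is monotonically
    related to the graph, hence in it; inserting that point makes the right side vanish and forces
    \<open>x = - u\<close>.\<close>
  have key: "(x + u) \<bullet> (x + u) \<le> (- x - v) \<bullet> (- u - y)" if "v \<in> T y" for y v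
    using zs(2)[OF graph[OF that]] above[of x u s] zs(1)
    unfolding z
    by (simp add: inner_add_left inner_add_right inner_diff_left inner_diff_right inner_commute)
  have mem: "- x \<in> T (- u)"
  proof (rule maximal_monotone_opD[OF T])
    fix y v assume "v \<in> T y"
    from key[OF this] show "0 \<le> (- x - v) \<bullet> (- u - y)"
      using inner_ge_zero[of "x + u"] by linarith
  qed
  from key[OF this] have "(x + u) \<bullet> (x + u) = 0" by (intro antisym) simp_all
  then have "x = - u" by (simp add: eq_neg_iff_add_eq_0)
  then show thesis using that[of "- u"] mem by simp
qed

lemma resolvent_exists:
  fixes T :: "'a::{real_inner,complete_space} \<Rightarrow> 'a set"
  assumes T: "maximal_monotone_op T" and l: "0 < l"
  shows "\<exists>x. (1 / l) *\<^sub>R (w - x) \<in> T x"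
proof -
  obtain x where "- x \<in> (\<lambda>v. l *\<^sub>R v + (- w)) ` T x"
    using minty_zero[OF maximal_monotone_op_affine[OF T l]] by metis
  then obtain v where v: "v \<in> T x" "- x = l *\<^sub>R v + (- w)" by blast
  then have "w - x = l *\<^sub>R v" by (simp add: algebra_simps)
  then have "(1 / l) *\<^sub>R (w - x) = v" using l by simp
  then show ?thesis using v(1) by metis
qed

text \<open>
  Solutions are the fixed points of \<open>y \<mapsto> R (y - l (q + A y))\<close>, where \<open>R\<close> is the resolvent of
  \<open>l T\<close>; for this choice of \<open>l\<close> the map is a contraction.
\<close>

lemma strongly_monotone_inclusion:
  fixes T :: "'a::{real_inner,complete_space} \<Rightarrow> 'a set" and A :: "'a \<Rightarrow>\<^sub>L 'a"
  assumes T: "maximal_monotone_op T" and c: "0 < c"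
    and A: "\<And>h. c * (norm h)\<^sup>2 \<le> blinfun_apply A h \<bullet> h"
  shows "\<exists>!y. - (q + blinfun_apply A y) \<in> T y"
proof (rule ex_ex1I)
  \<comment> \<open>Adding \<open>c\<close> gives \<open>0 < M\<close> and \<open>c \<le> M\<close>
    even in the zero space, so the square root in \<open>\<rho>\<close> has a nonnegative
    argument.\<close>
  define M where "M = norm A + c"
  have M: "0 < M" "norm A \<le> M" "c \<le> M" using c by (simp_all add: M_def add_nonneg_pos)
  \<comment> \<open>This \<open>l\<close> minimizes \<open>1 - 2 l c + l^2 M^2\<close>, the bound
    for the squared contraction factor; the minimum is \<open>1 - c^2 / M^2\<close>.\<close>
  define l where "l = c / M\<^sup>2"
  have l: "0 < l" using c M by (simp add: l_def)
  define R where "R w = (SOME x. (1 / l) *\<^sub>R (w - x) \<in> T x)" for w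
  have R: "(1 / l) *\<^sub>R (w - R w) \<in> T (R w)" for w
    unfolding R_def using resolvent_exists[OF T l] by (rule someI_ex)
  \<comment> \<open>Monotonicity makes \<open>R\<close> firmly nonexpansive, whatever
    \<open>SOME\<close> selects; Cauchy-Schwarz then gives the Lipschitz constant one.\<close>
  have nonexp: "norm (R w - R w') \<le> norm (w - w')" for w w'
  proof -
    have "0 \<le> ((1 / l) *\<^sub>R (w - R w) - (1 / l) *\<^sub>R (w' - R w')) \<bullet> (R w - R w')"
      by (rule monotone_opD[OF maximal_monotone_op_monotone[OF T] R R])
    then have "0 \<le> ((w - R w) - (w' - R w')) \<bullet> (R w - R w')"
      using l by (simp add: scaleR_diff_right[symmetric] zero_le_divide_iff)
    then have "norm (R w - R w') * norm (R w - R w') \<le> (w - w') \<bullet> (R w - R w')"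
      by (simp add: power2_norm_eq_inner[unfolded power2_eq_square] inner_diff_left
          inner_diff_right inner_commute)
    also have "\<dots> \<le> norm (w - w') * norm (R w - R w')" by (rule norm_cauchy_schwarz)
    finally show ?thesis
      by (cases "norm (R w - R w') = 0") (simp_all add: mult_le_cancel_right)
  qed
  define g where "g y = y - l *\<^sub>R (q + blinfun_apply A y)" for y
  define \<rho> where "\<rho> = sqrt (1 - c\<^sup>2 / M\<^sup>2)"
  have cM: "0 < c\<^sup>2 / M\<^sup>2" "c\<^sup>2 / M\<^sup>2 \<le> 1"
    using c M power_mono[of c M 2] by (simp_all add: field_simps)
  have \<rho>: "0 \<le> \<rho>" "\<rho> < 1" using cM by (simp_all add: \<rho>_def)
  have contr: "norm (g y - g y') \<le> \<rho> * norm (y - y')" for y y'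
  proof -
    define h where "h = y - y'"
    have "g y - g y' = h - l *\<^sub>R blinfun_apply A h"
      by (simp add: g_def h_def blinfun.diff_right algebra_simps)
    then have "(norm (g y - g y'))\<^sup>2
        = (norm h)\<^sup>2 - 2 * l * (blinfun_apply A h \<bullet> h) + l\<^sup>2 * (norm (blinfun_apply A h))\<^sup>2"
      unfolding power2_norm_eq_inner
      by (simp add: inner_diff_left inner_diff_right inner_commute power2_eq_square)
    also have "\<dots> \<le> (norm h)\<^sup>2 - 2 * l * (c * (norm h)\<^sup>2) + l\<^sup>2 * (M * norm h)\<^sup>2"
    proof -
      have "norm (blinfun_apply A h) \<le> M * norm h"
        using norm_blinfun[of A h] mult_right_mono[OF M(2) norm_ge_zero[of h]] by linarith
      then show ?thesis using A[of h] l
        by (intro add_mono diff_mono mult_left_mono power_mono) auto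
    qed
    also have "\<dots> = (\<rho> * norm h)\<^sup>2"
      using M cM by (simp add: l_def \<rho>_def power_mult_distrib power2_eq_square field_simps)
    finally show ?thesis
      unfolding h_def by (rule power2_le_imp_le) (use \<rho>(1) in simp)
  qed
  have "dist (R (g y)) (R (g y')) \<le> \<rho> * dist y y'" for y y'
    using order_trans[OF nonexp contr] by (simp add: dist_norm)
  then obtain y where "R (g y) = y"
    using banach_fix_type[OF \<rho>, of "\<lambda>y. R (g y)"] by auto
  then have "(1 / l) *\<^sub>R (g y - y) \<in> T y" using R[of "g y"] by simp
  moreover have "(1 / l) *\<^sub>R (g y - y) = - (q + blinfun_apply A y)"
    using l by (simp add: g_def)
  ultimately show "\<exists>y. - (q + blinfun_apply A y) \<in> T y" by metis
next
  fix y y' assume "- (q + blinfun_apply A y) \<in> T y" "- (q + blinfun_apply A y') \<in> T y'"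
  from monotone_opD[OF maximal_monotone_op_monotone[OF T] this]
  have "blinfun_apply A (y - y') \<bullet> (y - y') \<le> 0"
    by (simp add: blinfun.diff_right inner_diff_left)
  with A[of "y - y'"] have "c * (norm (y - y'))\<^sup>2 \<le> 0" by linarith
  with c show "y = y'" by (simp add: mult_le_0_iff)
qed

section \<open>Taylor remainder and positive operators\<close>

text \<open>Pairing with the remainder \<open>w\<close> itself reduces the claim to one real
  variable: \<open>\<phi>\<close> subtracts exactly the quadratic growth that the Lipschitz bound
  permits, so it cannot increase on the unit interval, and no integral is required.\<close>

lemma linear_remainder_bound:
  fixes F :: "'a::real_normed_vector \<Rightarrow> 'b::real_inner" and F' :: "'a \<Rightarrow> 'a \<Rightarrow>\<^sub>L 'b"
  assumes deriv: "\<And>z. z \<in> closed_segment x y \<Longrightarrow> (F has_derivative blinfun_apply (F' z)) (at z)"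
    and lip: "\<And>z. z \<in> closed_segment x y \<Longrightarrow> norm (F' z - F' x) \<le> L * norm (z - x)"
  shows "norm (F y - F x - blinfun_apply (F' x) (y - x)) \<le> L / 2 * (norm (y - x))\<^sup>2"
proof -
  define d where "d = y - x"
  define w where "w = F y - F x - blinfun_apply (F' x) d"
  define \<phi> where "\<phi> s = (F (x + s *\<^sub>R d) - s *\<^sub>R blinfun_apply (F' x) d) \<bullet> w
    - L / 2 * (norm d)\<^sup>2 * norm w * s\<^sup>2" for s :: real
  have "\<phi> 1 \<le> \<phi> 0"
  proof (rule DERIV_nonpos_imp_nonincreasing[of 0 1 \<phi>])
    fix s :: real assume s: "0 \<le> s" "s \<le> 1"
    let ?z = "x + s *\<^sub>R d"
    have z: "?z \<in> closed_segment x y"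
      using s by (auto simp: closed_segment_def d_def algebra_simps intro!: exI[of _ s])
    have "((\<lambda>s. F (x + s *\<^sub>R d)) has_derivative (\<lambda>h. blinfun_apply (F' ?z) (h *\<^sub>R d))) (at s)"
      by (rule has_derivative_compose[where f = "\<lambda>s. x + s *\<^sub>R d", OF _ deriv[OF z]])
        (auto intro!: derivative_eq_intros)
    then have *: "(\<phi> has_real_derivative (blinfun_apply (F' ?z) d - blinfun_apply (F' x) d) \<bullet> w
        - L * s * (norm d)\<^sup>2 * norm w) (at s)"
      unfolding \<phi>_def has_field_derivative_def
      by (auto intro!: derivative_eq_intros
          simp: blinfun.scaleR_right inner_diff_left inner_diff_right algebra_simps)
    have "(blinfun_apply (F' ?z) d - blinfun_apply (F' x) d) \<bullet> w
        \<le> norm (blinfun_apply (F' ?z - F' x) d) * norm w"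
      unfolding blinfun.diff_left[symmetric] by (rule norm_cauchy_schwarz)
    also have "\<dots> \<le> norm (F' ?z - F' x) * norm d * norm w"
      by (intro mult_right_mono norm_blinfun) simp
    also have "\<dots> \<le> L * norm (?z - x) * norm d * norm w"
      by (intro mult_right_mono lip z) simp_all
    also have "\<dots> = L * s * (norm d)\<^sup>2 * norm w"
      using s by (simp add: power2_eq_square)
    finally show "\<exists>D. (\<phi> has_real_derivative D) (at s) \<and> D \<le> 0"
      using * by (intro exI[of _ "_ - L * s * (norm d)\<^sup>2 * norm w"]) (rule conjI, assumption, linarith)
  qed simp
  then have "w \<bullet> w \<le> L / 2 * (norm d)\<^sup>2 * norm w"
    unfolding \<phi>_def by (simp add: d_def w_def inner_diff_left)
  then have "norm w * norm w \<le> (L / 2 * (norm d)\<^sup>2) * norm w"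
    by (simp add: power2_norm_eq_inner[symmetric] power2_eq_square)
  \<comment> \<open>No sign of \<open>L\<close> is assumed. For \<open>d \<noteq> 0\<close> it
    follows from the Lipschitz bound at \<open>y\<close>; it settles the case \<open>w = 0\<close>
    below.\<close>
  moreover have "0 \<le> L / 2 * (norm d)\<^sup>2"
  proof (cases "d = 0")
    case False
    have "0 \<le> L * norm d" using order_trans[OF norm_ge_zero lip[of y]] unfolding d_def by simp
    with False show ?thesis by (simp add: zero_le_mult_iff)
  qed simp
  ultimately have "norm w \<le> L / 2 * (norm d)\<^sup>2"
    by (cases "norm w = 0") (simp_all add: mult_le_cancel_right)
  then show ?thesis by (simp add: w_def d_def)
qed

lemma sym_part_self_adjoint: "adjoint_op G = G \<Longrightarrow> sym_part G = G"
  by (simp add: sym_part_def scaleR_2[symmetric])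

lemma is_inverse_op_right: "is_inverse_op G J \<Longrightarrow> blinfun_apply G (blinfun_apply J x) = x"
  unfolding is_inverse_op_def
  by (metis blinfun_apply_blinfun_compose blinfun_apply_id_blinfun id_apply)

text \<open>
  Positivity of \<open>G\<close> at \<open>x - J x / \<parallel>J\<parallel>\<close>, where \<open>J\<close> is the inverse of \<open>G\<close>, replaces the use of
  the square root of \<open>G\<close>.
\<close>

lemma positive_op_inverse_bound:
  fixes G :: "'a::{real_inner,complete_space} \<Rightarrow>\<^sub>L 'a"
  assumes G: "positive_op G" and J: "is_inverse_op G J"
  shows "(norm x)\<^sup>2 \<le> norm J * (blinfun_apply G x \<bullet> x)"
proof (cases "norm J = 0")
  \<comment> \<open>Here \<open>J = 0\<close>, so \<open>x = G (J x) = 0\<close>.\<close>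
  case True
  then show ?thesis using is_inverse_op_right[OF J, of x] by simp
next
  case False
  define n where "n = norm J"
  have n: "0 < n" using False by (simp add: n_def)
  let ?j = "blinfun_apply J x"
  have "blinfun_apply G x \<bullet> ?j = x \<bullet> blinfun_apply G ?j"
    using inner_adjoint_op[of G x ?j] G by (simp add: positive_op_def)
  then have Gxj: "blinfun_apply G x \<bullet> ?j = x \<bullet> x" by (simp add: is_inverse_op_right[OF J])
  have "x \<bullet> ?j \<le> norm x * norm ?j" by (rule norm_cauchy_schwarz)
  also have "\<dots> \<le> norm x * (n * norm x)"
    unfolding n_def by (intro mult_left_mono norm_blinfun) simp
  finally have xj: "x \<bullet> ?j \<le> n * (x \<bullet> x)" by (simp add: dot_square_norm power2_eq_square mult_ac)
  have "0 \<le> blinfun_apply G (x - (1 / n) *\<^sub>R ?j) \<bullet> (x - (1 / n) *\<^sub>R ?j)"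
    using G by (simp add: positive_op_def)
  also have "\<dots> = blinfun_apply G x \<bullet> x - 2 / n * (x \<bullet> x) + (1 / n)\<^sup>2 * (x \<bullet> ?j)"
    by (simp add: blinfun.diff_right blinfun.scaleR_right inner_diff_left inner_diff_right
        is_inverse_op_right[OF J] Gxj power2_eq_square) (simp add: diff_divide_distrib)
  also have "\<dots> \<le> blinfun_apply G x \<bullet> x - 2 / n * (x \<bullet> x) + (1 / n)\<^sup>2 * (n * (x \<bullet> x))"
    by (intro add_left_mono mult_left_mono xj) simp
  also have "\<dots> = blinfun_apply G x \<bullet> x - (x \<bullet> x) / n"
    using n by (simp add: power2_eq_square)
  finally show ?thesis using n by (simp add: n_def dot_square_norm field_simps)
qed

section \<open>Convergence radius and the majorizing sequence\<close>

lemma zero_mem_elt_set_plus: "0 \<in> a +o B \<longleftrightarrow> - a \<in> B" for a :: "'a::ab_group_add"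
proof
  show "- a \<in> B" if "0 \<in> a +o B"
  proof -
    from that obtain b where "b \<in> B" "0 = a + b" unfolding elt_set_plus_def by blast
    then show ?thesis using minus_unique[of a b] by simp
  qed
  show "0 \<in> a +o B" if "- a \<in> B"
    using set_plus_intro2[OF that, of a] by simp
qed

text \<open>Strictness leaves room for the closed ball, so at radius \<open>2 / (3 * K)\<close> the
  set contains the cycle that proves sharpness.\<close>

lemma ball_subset_of_less_ball_radius:
  assumes "ereal s < ball_radius \<Omega> z"
  shows "cball z s \<subseteq> \<Omega>"
proof -
  obtain t where "s < t" "ball z t \<subseteq> \<Omega>"
    using assms unfolding ball_radius_def less_Sup_iff by auto
  then show ?thesis by (auto simp: subset_iff)
qed

lemma ball_radius_pos:
  assumes "open \<Omega>" "z \<in> \<Omega>"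
  shows "0 < ball_radius \<Omega> z"
proof -
  obtain e where "0 < e" "ball z e \<subseteq> \<Omega>" using assms openE by blast
  then show ?thesis
    unfolding ball_radius_def less_Sup_iff by (intro bexI[of _ "ereal e"]) auto
qed

lemma newton_radius:
  assumes "open \<Omega>" "z \<in> \<Omega>" "0 < K"
  shows "0 < newton_radius \<Omega> z K" "newton_radius \<Omega> z K \<le> 2 / (3 * K)"
    "ball z (newton_radius \<Omega> z K) \<subseteq> \<Omega>"
    "ereal (2 / (3 * K)) < ball_radius \<Omega> z \<Longrightarrow> newton_radius \<Omega> z K = 2 / (3 * K)"
proof -
  define m where "m = min (ball_radius \<Omega> z) (ereal (2 / (3 * K)))"
  have m: "0 < m" "m \<le> ereal (2 / (3 * K))" "m \<le> ball_radius \<Omega> z"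
    using ball_radius_pos[OF assms(1,2)] assms(3) by (auto simp: m_def)
  \<comment> \<open>As \<open>m\<close> is positive and bounded by a finite number,
    \<open>real_of_ereal\<close> does not return its default value for infinity.\<close>
  have r: "ereal (newton_radius \<Omega> z K) = m"
    unfolding newton_radius_def m_def[symmetric] using m(1,2) by (cases m) auto
  show "0 < newton_radius \<Omega> z K" "newton_radius \<Omega> z K \<le> 2 / (3 * K)"
    using m(1,2) unfolding r[symmetric] by auto
  show "ball z (newton_radius \<Omega> z K) \<subseteq> \<Omega>"
  proof
    fix y assume "y \<in> ball z (newton_radius \<Omega> z K)"
    then have "ereal (dist z y) < ball_radius \<Omega> z"
      using m(3) unfolding r[symmetric] by (auto intro: less_le_trans[of _ "ereal (newton_radius \<Omega> z K)"])
    from ball_subset_of_less_ball_radius[OF this] show "y \<in> \<Omega>" by (auto simp: subset_iff)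
  qed
  show "newton_radius \<Omega> z K = 2 / (3 * K)" if "ereal (2 / (3 * K)) < ball_radius \<Omega> z"
    using that by (simp add: newton_radius_def min_absorb2)
qed

lemma strict_antimono_SucI:
  fixes f :: "nat \<Rightarrow> real"
  assumes "\<And>k. f (Suc k) < f k"
  shows "strict_antimono_on UNIV f"
proof (rule monotone_onI)
  fix i j :: nat assume "i < j"
  then show "f i > f j"
    using lift_Suc_mono_less[of "\<lambda>k. - f k" i j] assms by simp
qed

context
  fixes K \<tau> :: real
  assumes K: "0 < K" and \<tau>: "0 < \<tau>" "3 * K * \<tau> < 2"
begin

private abbreviation (input) t where "t \<equiv> scalar_newton K \<tau>"

lemma scalar_newton_bounds:
  "0 < t k" "t k \<le> (K / 2 * \<tau> / (1 - K * \<tau>)) ^ k * \<tau>" "t k \<le> \<tau>" "t (Suc k) < t k"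
proof -
  \<comment> \<open>The quotient \<open>t (Suc k) / t k\<close> grows with \<open>t k\<close>, so
    its value \<open>q\<close> at the start bounds all of them. The condition
    \<open>3 K \<tau> < 2\<close> is equivalent to \<open>q < 1\<close> when
    \<open>K \<tau> < 1\<close>, hence the radius \<open>2 / (3 * K)\<close>.\<close>
  define q where "q = K / 2 * \<tau> / (1 - K * \<tau>)"
  have K\<tau>: "0 < K * \<tau>" "K * \<tau> < 2 / 3" using K \<tau> by auto
  have q: "0 < q" "q < 1" using K\<tau> by (simp_all add: q_def field_simps)
  have step: "0 < t (Suc k) \<and> t (Suc k) \<le> q * t k" if "0 < t k" "t k \<le> \<tau>" for k
  proof -
    have *: "0 < K * t k" "K * t k \<le> K * \<tau>" using K that by auto
    then have pos: "0 < 1 - K * t k" using K\<tau> by linarith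
    have "t (Suc k) = K / 2 * t k / (1 - K * t k) * t k" by (simp add: power2_eq_square)
    also have "\<dots> \<le> q * t k"
      unfolding q_def using * K\<tau> pos that K by (intro mult_right_mono frac_le mult_left_mono) auto
    finally show ?thesis using pos that K by simp
  qed
  have main: "0 < t k \<and> t k \<le> q ^ k * \<tau> \<and> t k \<le> \<tau>" for k
  proof (induction k)
    case 0 then show ?case using \<tau> by simp
  next
    case (Suc k)
    then have s: "0 < t (Suc k)" "t (Suc k) \<le> q * t k" using step[of k] by auto
    moreover have "q * t k \<le> q * (q ^ k * \<tau>)"
      using Suc q by (intro mult_left_mono) auto
    moreover have "q * t k \<le> 1 * \<tau>"
      using Suc q by (intro mult_mono) auto
    ultimately show ?case by (auto simp: mult_ac simp del: scalar_newton.simps)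
  qed
  then show "0 < t k" "t k \<le> (K / 2 * \<tau> / (1 - K * \<tau>)) ^ k * \<tau>" "t k \<le> \<tau>"
    unfolding q_def[symmetric] by blast+
  have "t (Suc k) \<le> q * t k" "q * t k < 1 * t k"
    using step main q by (blast, intro mult_strict_right_mono, auto)
  then show "t (Suc k) < t k" by simp
qed

lemma scalar_newton_mult_less: "K * t k < 2 / 3"
proof -
  have "K * t k \<le> K * \<tau>" using K by (intro mult_left_mono scalar_newton_bounds(3)) simp
  then show ?thesis using \<tau> by linarith
qed

lemma scalar_newton_tendsto: "t \<longlonglongrightarrow> 0"
proof (rule tendsto_sandwich[OF _ _ tendsto_const])
  have "0 < K * \<tau>" using K \<tau> by simp
  then have "0 \<le> K / 2 * \<tau> / (1 - K * \<tau>)" "K / 2 * \<tau> / (1 - K * \<tau>) < 1"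
    using \<tau> by (simp_all add: field_simps)
  then show "(\<lambda>k. (K / 2 * \<tau> / (1 - K * \<tau>)) ^ k * \<tau>) \<longlonglongrightarrow> 0"
    by (intro tendsto_mult_left_zero LIMSEQ_power_zero) (simp only: real_norm_def abs_of_nonneg)
qed (use scalar_newton_bounds in \<open>auto intro!: eventuallyI less_imp_le\<close>)

lemma scalar_newton_ratio: "t (Suc k) / (t k)\<^sup>2 = K / 2 / (1 - K * t k)"
  using scalar_newton_bounds(1)[of k] by simp

text \<open>The ratio is an increasing function of \<open>t k\<close> alone. Arbitrary indices allow
  comparison with the successor as well as with index \<open>0\<close>.\<close>

lemma scalar_newton_ratio_less: "t (Suc j) / (t j)\<^sup>2 < t (Suc k) / (t k)\<^sup>2" if "t j < t k"
  unfolding scalar_newton_ratio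
  using that K scalar_newton_mult_less[of k] scalar_newton_mult_less[of j]
  by (intro divide_strict_left_mono mult_pos_pos) auto

end

section \<open>Newton iterates\<close>

text \<open>The assumption \<open>nontrivial\<close> excludes the zero space, where the inverse has
  norm zero and division by \<open>\<beta>\<close> would be meaningless. A starting point different
  from \<open>xs\<close> provides it.\<close>

locale newton =
  fixes \<Omega> :: "'a::{real_inner,complete_space} set"
    and F :: "'a \<Rightarrow> 'a"
    and F' :: "'a \<Rightarrow> 'a \<Rightarrow>\<^sub>L 'a"
    and T :: "'a \<Rightarrow> 'a set"
    and xs :: 'a
    and K :: real
  assumes problem: "newton_problem \<Omega> F F' T xs K"
    and nontrivial: "\<exists>x. x \<noteq> xs"
begin

abbreviation (input) r where "r \<equiv> newton_radius \<Omega> xs K"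

definition \<beta> where "\<beta> = norm (inverse_op (sym_part (F' xs)))"

lemma K_pos: "0 < K" and xs_mem: "xs \<in> \<Omega>" and open_dom: "open \<Omega>"
  and maximal: "maximal_monotone_op T"
  and deriv: "x \<in> \<Omega> \<Longrightarrow> (F has_derivative blinfun_apply (F' x)) (at x)"
  using problem unfolding newton_problem_def by blast+

lemmas monotone = maximal_monotone_op_monotone[OF maximal]

lemma xs_solution: "- F xs \<in> T xs"
  using problem unfolding newton_problem_def zero_mem_elt_set_plus by blast

lemmas radius = newton_radius[OF open_dom xs_mem K_pos]

lemma derivative_at_solution_bound: "(norm h)\<^sup>2 \<le> \<beta> * (blinfun_apply (F' xs) h \<bullet> h)"
proof -
  have pos: "positive_op (F' xs)" and inv: "invertible_op (sym_part (F' xs))"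
    using problem unfolding newton_problem_def by blast+
  have G: "sym_part (F' xs) = F' xs"
    using pos by (simp add: positive_op_def sym_part_self_adjoint)
  from inv obtain J where J: "is_inverse_op (F' xs) J" unfolding G invertible_op_def by blast
  show ?thesis
    using positive_op_inverse_bound[OF pos J] by (simp add: \<beta>_def G inverse_op_eq[OF J])
qed

lemma \<beta>_pos: "0 < \<beta>"
proof -
  obtain x where "x \<noteq> xs" using nontrivial by blast
  then have "\<beta> \<noteq> 0" using derivative_at_solution_bound[of "x - xs"] by auto
  then show ?thesis by (simp add: \<beta>_def)
qed

lemma lipschitz: "x \<in> \<Omega> \<Longrightarrow> y \<in> \<Omega> \<Longrightarrow> norm (F' x - F' y) \<le> K / \<beta> * norm (x - y)"
  using problem \<beta>_pos unfolding newton_problem_def \<beta>_def[symmetric]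
  by (simp add: field_simps)

lemma ball_bounds:
  assumes "x \<in> ball xs r"
  shows "x \<in> \<Omega>" "norm (x - xs) < r" "K * norm (x - xs) < 2 / 3"
proof -
  show "x \<in> \<Omega>" using assms radius(3) by blast
  show *: "norm (x - xs) < r" using assms by (simp add: dist_norm norm_minus_commute)
  then have "norm (x - xs) < 2 / (3 * K)" using radius(2) by linarith
  then show "K * norm (x - xs) < 2 / 3" using K_pos by (simp add: field_simps)
qed

lemma xs_ball: "xs \<in> ball xs r"
  using radius(1) by simp

lemma remainder:
  assumes "x \<in> ball xs r" "y \<in> ball xs r"
  shows "norm (F y - F x - blinfun_apply (F' x) (y - x)) \<le> K / \<beta> / 2 * (norm (y - x))\<^sup>2"
proof -
  have "closed_segment x y \<subseteq> \<Omega>"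
    using closed_segment_subset[OF assms convex_ball] radius(3) by blast
  then show ?thesis
    using assms ball_bounds(1) by (intro linear_remainder_bound deriv lipschitz) auto
qed

lemma derivative_coercive:
  assumes "x \<in> ball xs r"
  shows "(1 - K * norm (x - xs)) / \<beta> * (norm h)\<^sup>2 \<le> blinfun_apply (F' x) h \<bullet> h"
proof -
  have "- (blinfun_apply (F' x - F' xs) h \<bullet> h) \<le> norm (blinfun_apply (F' x - F' xs) h) * norm h"
    using norm_cauchy_schwarz[of "- blinfun_apply (F' x - F' xs) h" h] by simp
  also have "\<dots> \<le> norm (F' x - F' xs) * norm h * norm h"
    by (intro mult_right_mono norm_blinfun) simp
  also have "\<dots> \<le> K / \<beta> * norm (x - xs) * norm h * norm h"
    by (intro mult_right_mono lipschitz ball_bounds(1) assms xs_mem) simp_all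
  also have "\<dots> = K / \<beta> * norm (x - xs) * (norm h)\<^sup>2" by (simp add: power2_eq_square)
  finally have "blinfun_apply (F' xs) h \<bullet> h - K / \<beta> * norm (x - xs) * (norm h)\<^sup>2
      \<le> blinfun_apply (F' x) h \<bullet> h"
    by (simp add: blinfun.diff_left inner_diff_left)
  moreover have "(norm h)\<^sup>2 / \<beta> \<le> blinfun_apply (F' xs) h \<bullet> h"
    using derivative_at_solution_bound[of h] \<beta>_pos by (simp add: field_simps)
  ultimately show ?thesis by (simp add: diff_divide_distrib left_diff_distrib)
qed

definition step_solution where
  "step_solution x y \<longleftrightarrow> 0 \<in> (F x + blinfun_apply (F' x) (y - x)) +o T y"

lemma step_exists_unique:
  assumes "x \<in> ball xs r"
  shows "\<exists>!y. step_solution x y"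
proof -
  have "0 < (1 - K * norm (x - xs)) / \<beta>"
    using ball_bounds(3)[OF assms] \<beta>_pos by simp
  from strongly_monotone_inclusion[OF maximal this derivative_coercive[OF assms],
      of "F x - blinfun_apply (F' x) x"]
  show ?thesis
    unfolding step_solution_def zero_mem_elt_set_plus by (simp add: blinfun.diff_right algebra_simps)
qed

lemma step_error:
  assumes x: "x \<in> ball xs r" and y: "step_solution x y"
  shows "norm (y - xs) \<le> K / 2 * (norm (x - xs))\<^sup>2 / (1 - K * norm (x - xs))"
proof -
  define e where "e = norm (x - xs)"
  \<comment> \<open>The linearization error at \<open>xs\<close> seen from \<open>x\<close>.
    Monotonicity of \<open>T\<close> between \<open>y\<close> and \<open>xs\<close> bounds the
    quadratic form of \<open>F' x\<close> at \<open>y - xs\<close> by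
    \<open>w \<bullet> (y - xs)\<close>.\<close>
  define w where "w = F xs - F x - blinfun_apply (F' x) (xs - x)"
  have w: "norm w \<le> K / \<beta> / 2 * e\<^sup>2"
    using remainder[OF x xs_ball] by (simp add: w_def e_def norm_minus_commute)
  have e: "0 < 1 - K * e" using ball_bounds(3)[OF x] by (simp add: e_def)
  have "- (F x + blinfun_apply (F' x) (y - x)) \<in> T y"
    using y unfolding step_solution_def zero_mem_elt_set_plus .
  from monotone_opD[OF monotone this xs_solution]
  have "0 \<le> (w - blinfun_apply (F' x) (y - xs)) \<bullet> (y - xs)"
    by (simp add: w_def blinfun.diff_right algebra_simps)
  then have "blinfun_apply (F' x) (y - xs) \<bullet> (y - xs) \<le> w \<bullet> (y - xs)"
    by (simp add: inner_diff_left)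
  also have "\<dots> \<le> norm w * norm (y - xs)" by (rule norm_cauchy_schwarz)
  also have "\<dots> \<le> K / \<beta> / 2 * e\<^sup>2 * norm (y - xs)" by (intro mult_right_mono w) simp
  finally have "(1 - K * e) / \<beta> * (norm (y - xs))\<^sup>2 \<le> K / \<beta> / 2 * e\<^sup>2 * norm (y - xs)"
    using derivative_coercive[OF x, of "y - xs"] by (simp add: e_def)
  \<comment> \<open>Coercivity and remainder bound both carry the factor \<open>1 / \<beta>\<close>,
    which cancels here.\<close>
  then have "\<beta> * ((1 - K * e) / \<beta> * (norm (y - xs))\<^sup>2)
      \<le> \<beta> * (K / \<beta> / 2 * e\<^sup>2 * norm (y - xs))"
    using \<beta>_pos by (intro mult_left_mono) auto
  then have "(1 - K * e) * norm (y - xs) * norm (y - xs) \<le> (K / 2 * e\<^sup>2) * norm (y - xs)"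
    using \<beta>_pos by (simp add: power2_eq_square mult_ac)
  moreover have "0 \<le> K / 2 * e\<^sup>2" using K_pos by simp
  ultimately have "(1 - K * e) * norm (y - xs) \<le> K / 2 * e\<^sup>2"
    by (cases "norm (y - xs) = 0") (simp_all add: mult_le_cancel_right)
  then show ?thesis using e unfolding e_def[symmetric] by (subst pos_le_divide_eq) (simp_all only: mult.commute)
qed

text \<open>Linearizing at \<open>xs\<close> keeps the full coercivity of \<open>F' xs\<close>, and
  a second solution at distance \<open>n\<close> would satisfy \<open>1 \<le> K n / 2\<close>. This
  is the source of the bound \<open>2 / K\<close>; in the ball even
  \<open>K n < 2 / 3\<close>.\<close>

lemma solution_unique:
  assumes x: "x \<in> ball xs r" and sol: "0 \<in> F x +o T x"
  shows "x = xs"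
proof (rule ccontr)
  assume "x \<noteq> xs"
  define n where "n = norm (x - xs)"
  define w where "w = F x - F xs - blinfun_apply (F' xs) (x - xs)"
  have n: "0 < n" using \<open>x \<noteq> xs\<close> by (simp add: n_def)
  have "- F x \<in> T x" using sol unfolding zero_mem_elt_set_plus .
  from monotone_opD[OF monotone this xs_solution]
  have "blinfun_apply (F' xs) (x - xs) \<bullet> (x - xs) \<le> (- w) \<bullet> (x - xs)"
    by (simp add: w_def inner_diff_left)
  also have "\<dots> \<le> norm w * n" unfolding n_def using norm_cauchy_schwarz[of "- w"] by simp
  also have "\<dots> \<le> K / \<beta> / 2 * n\<^sup>2 * n"
    using remainder[OF xs_ball x] n by (intro mult_right_mono) (auto simp: w_def n_def)
  finally have "\<beta> * (blinfun_apply (F' xs) (x - xs) \<bullet> (x - xs)) \<le> \<beta> * (K / \<beta> / 2 * n\<^sup>2 * n)"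
    using \<beta>_pos by (intro mult_left_mono) auto
  with derivative_at_solution_bound[of "x - xs"] have "n\<^sup>2 * 1 \<le> n\<^sup>2 * (K / 2 * n)"
    using \<beta>_pos unfolding n_def[symmetric] by (simp add: mult_ac)
  then have "1 \<le> K / 2 * n" using n by (subst (asm) mult_le_cancel_left_pos) auto
  then show False using ball_bounds(3)[OF x] by (simp add: n_def)
qed

lemma start_bounds:
  assumes "x0 \<in> ball xs r - {xs}"
  shows "0 < norm (xs - x0)" "norm (xs - x0) < r" "3 * K * norm (xs - x0) < 2"
  using assms ball_bounds(2,3)[of x0] by (auto simp: norm_minus_commute)

lemma newton_sequence_exists:
  assumes x0: "x0 \<in> ball xs r - {xs}"
  defines "t \<equiv> scalar_newton K (norm (xs - x0))"
  obtains x where "newton_sequence \<Omega> F F' T x0 x" "range x \<subseteq> ball xs r" "x \<longlonglongrightarrow> xs"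
    "\<And>k. norm (xs - x (Suc k)) \<le> K / 2 * (1 / (1 - K * t k)) * (norm (x k - xs))\<^sup>2"
proof -
  note start = start_bounds[OF x0]
  note t_bounds = scalar_newton_bounds[OF K_pos start(1,3), folded t_def]
  note Kt = scalar_newton_mult_less[OF K_pos start(1,3), folded t_def]
  \<comment> \<open>The description is known to denote the solution only for \<open>z\<close> in the
    ball; \<open>le\<close> below shows that the iterates stay there.\<close>
  define step where "step z = (THE y. step_solution z y)" for z
  define x where "x k = (step ^^ k) x0" for k
  have x_Suc: "x (Suc k) = step (x k)" for k by (simp add: x_def)
  have step: "step_solution z y \<longleftrightarrow> y = step z" if "z \<in> ball xs r" for z y
    unfolding step_def using step_exists_unique[OF that] by (metis the_equality)
  have in_ball: "z \<in> ball xs r" if "norm (z - xs) \<le> t k" for z k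
    using that t_bounds(3)[of k] start(2) by (simp add: dist_norm norm_minus_commute)
  \<comment> \<open>Conditional on the majorization at \<open>k\<close>, so that it can serve inside
    the induction and again for the final estimate.\<close>
  have err: "norm (x (Suc k) - xs) \<le> K / 2 * (1 / (1 - K * t k)) * (norm (x k - xs))\<^sup>2"
    if le: "norm (x k - xs) \<le> t k" for k
  proof -
    note b = in_ball[OF le]
    have "norm (x (Suc k) - xs) \<le> K / 2 * (norm (x k - xs))\<^sup>2 / (1 - K * norm (x k - xs))"
      using step[OF b] by (intro step_error[OF b]) (simp add: x_Suc)
    also have "\<dots> \<le> K / 2 * (norm (x k - xs))\<^sup>2 / (1 - K * t k)"
      using le Kt[of k] ball_bounds(3)[OF b] K_pos
      by (intro divide_left_mono mult_pos_pos diff_left_mono mult_left_mono) auto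
    finally show ?thesis by simp
  qed
  have le: "norm (x k - xs) \<le> t k" for k
  proof (induction k)
    case 0
    then show ?case by (simp add: x_def t_def norm_minus_commute)
  next
    case (Suc k)
    have "norm (x (Suc k) - xs) \<le> K / 2 * (1 / (1 - K * t k)) * (norm (x k - xs))\<^sup>2"
      by (rule err[OF Suc])
    \<comment> \<open>With the error replaced by its majorant \<open>t k\<close>, the bound becomes
      the scalar recursion.\<close>
    also have "\<dots> \<le> K / 2 * (1 / (1 - K * t k)) * (t k)\<^sup>2"
      using Suc Kt[of k] K_pos by (intro mult_left_mono power_mono) auto
    also have "\<dots> = t (Suc k)" by (simp add: t_def)
    finally show ?case .
  qed
  note b = in_ball[OF le]
  have "newton_sequence \<Omega> F F' T x0 x"
    unfolding newton_sequence_def step_solution_def[symmetric]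
    using step[OF b] ball_bounds(1)[OF b] x_Suc by (auto simp: x_def)
  moreover have "x \<longlonglongrightarrow> xs"
  proof (subst LIM_zero_iff[symmetric], rule tendsto_norm_zero_cancel,
      rule tendsto_sandwich[OF _ _ tendsto_const])
    show "t \<longlonglongrightarrow> 0" unfolding t_def by (rule scalar_newton_tendsto[OF K_pos start(1,3)])
  qed (use le in auto)
  moreover have "norm (xs - x (Suc k)) \<le> K / 2 * (1 / (1 - K * t k)) * (norm (x k - xs))\<^sup>2" for k
    using err[OF le] by (simp add: norm_minus_commute)
  ultimately show thesis using b that by blast
qed

end

lemma convergence_radius_newton_radius: "convergence_radius \<Omega> xs K (newton_radius \<Omega> xs K)"
  unfolding convergence_radius_def
proof (intro allI impI ballI)
  fix F F' T x0
  assume "newton_problem \<Omega> F F' T xs K" and x0: "x0 \<in> ball xs (newton_radius \<Omega> xs K) - {xs}"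
  then interpret newton \<Omega> F F' T xs K by unfold_locales blast+
  show "\<exists>x. newton_sequence \<Omega> F F' T x0 x \<and> x \<longlonglongrightarrow> xs"
    by (rule newton_sequence_exists[OF x0]) blast
qed

section \<open>Sharpness of the radius\<close>

text \<open>An odd function with a Lipschitz but nonsmooth derivative: the symmetric nonlinearity of
  the counterexample. At \<open>0\<close> the difference quotient is
  \<open>\<bar>h\<bar>\<close>.\<close>

lemma has_real_derivative_mult_abs: "((\<lambda>s. s * \<bar>s\<bar>) has_real_derivative 2 * \<bar>s\<bar>) (at s)"
proof -
  consider "0 < s" | "s < 0" | "s = 0" by linarith
  then show ?thesis
  proof cases
    case 1
    have "((\<lambda>s. s * s) has_real_derivative 2 * \<bar>s\<bar>) (at s)"
      using 1 by (auto intro!: derivative_eq_intros)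
    then show ?thesis
      by (rule has_field_derivative_transform_within_open[of _ _ _ "{0<..}"]) (use 1 in auto)
  next
    case 2
    have "((\<lambda>s. - (s * s)) has_real_derivative 2 * \<bar>s\<bar>) (at s)"
      using 2 by (auto intro!: derivative_eq_intros)
    then show ?thesis
      by (rule has_field_derivative_transform_within_open[of _ _ _ "{..<0}"]) (use 2 in auto)
  next
    case 3
    have "(\<lambda>h::real. \<bar>h\<bar>) \<midarrow>0\<rightarrow> 0" by (rule tendsto_rabs_zero) simp
    then have "(\<lambda>h::real. ((0 + h) * \<bar>0 + h\<bar> - 0 * \<bar>0\<bar>) / h) \<midarrow>0\<rightarrow> 0"
      by (rule Lim_transform_eventually) (auto simp: eventually_at_filter)
    then show ?thesis using 3 by (simp add: DERIV_def)
  qed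
qed

lemma adjoint_op_id: "adjoint_op id_blinfun = id_blinfun"
proof (rule blinfun_eqI)
  fix y :: 'a
  have "x \<bullet> y = x \<bullet> blinfun_apply (adjoint_op id_blinfun) y" for x
    using inner_adjoint_op[of id_blinfun x y] by simp
  then show "blinfun_apply (adjoint_op id_blinfun) y = blinfun_apply id_blinfun y"
    by (metis blinfun_apply_id_blinfun id_apply vector_eq_ldot)
qed

lemma is_inverse_op_id: "is_inverse_op id_blinfun id_blinfun"
  by (auto simp: is_inverse_op_def intro!: blinfun_eqI)

lemma maximal_monotone_op_zero: "maximal_monotone_op (\<lambda>x::'a::real_inner. {0::'a})"
  unfolding maximal_monotone_op_def monotone_op_def set_dom_def
proof (intro conjI allI impI)
  fix x u :: 'a
  assume "\<forall>y\<in>{x. {0::'a} \<noteq> {}}. \<forall>v\<in>{0}. 0 \<le> (u - v) \<bullet> (x - y)"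
  then have "\<forall>y. 0 \<le> u \<bullet> (x - y)" by simp
  \<comment> \<open>Testing at \<open>y = x + u\<close> leaves minus the squared norm of
    \<open>u\<close>.\<close>
  then have "0 \<le> u \<bullet> (x - (x + u))" by (rule spec)
  then have "u \<bullet> u = 0" by (intro antisym) simp_all
  then show "u \<in> {0}" by simp
qed simp_all

text \<open>
  For \<open>T = {0}\<close> and \<open>F\<close> acting along a unit vector \<open>e\<close> as \<open>s \<mapsto> s - (K/2) s \<bar>s\<bar>\<close>, the two
  points \<open>xs \<plusminus> 2/(3K) e\<close> form a Newton cycle of period two.
\<close>

lemma convergence_radius_le:
  fixes \<Omega> :: "'a::{real_inner,complete_space} set"
  assumes "open \<Omega>" "xs \<in> \<Omega>" and K: "0 < K" and "x1 \<noteq> xs"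
    and sub: "cball xs (2 / (3 * K)) \<subseteq> \<Omega>"
    and conv: "convergence_radius \<Omega> xs K \<rho>"
  shows "\<rho> \<le> 2 / (3 * K)"
proof (rule ccontr)
  assume gt: "\<not> \<rho> \<le> 2 / (3 * K)"
  define s where "s = 2 / (3 * K)"
  have s: "0 < s" "K * s = 2 / 3" "s < \<rho>"
    using K gt by (simp_all add: s_def)
  define e where "e = sgn (x1 - xs)"
  have e: "norm e = 1" using \<open>x1 \<noteq> xs\<close> by (simp add: e_def norm_sgn)
  then have ee: "e \<bullet> e = 1" by (simp add: dot_square_norm)
  define f where "f x = (x - xs) \<bullet> e" for x
  \<comment> \<open>The orthogonal projection onto the line of \<open>e\<close>; \<open>F\<close> is
    a translated identity except along this line.\<close>
  define P where "P = blinfun_scaleR_left e o\<^sub>L blinfun_inner_left e"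
  have P: "blinfun_apply P h = (h \<bullet> e) *\<^sub>R e" for h by (simp add: P_def)
  have nP: "norm P \<le> 1"
    by (rule norm_blinfun_bound) (use Cauchy_Schwarz_ineq2[of _ e] in \<open>simp_all add: P e\<close>)
  define F where "F x = (x - xs) - (K / 2 * (f x * \<bar>f x\<bar>)) *\<^sub>R e" for x
  define F' where "F' x = id_blinfun - (K * \<bar>f x\<bar>) *\<^sub>R P" for x
  have deriv: "(F has_derivative blinfun_apply (F' x)) (at x)" for x
  proof -
    have "(f has_derivative (\<lambda>h. h \<bullet> e)) (at x)"
      unfolding f_def by (auto intro!: derivative_eq_intros)
    from has_derivative_compose[OF this
        has_real_derivative_mult_abs[unfolded has_field_derivative_def]]
    have "((\<lambda>x. f x * \<bar>f x\<bar>) has_derivative (\<lambda>h. 2 * \<bar>f x\<bar> * (h \<bullet> e))) (at x)" .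
    then have "(F has_derivative (\<lambda>h. h - (K / 2 * (2 * \<bar>f x\<bar> * (h \<bullet> e))) *\<^sub>R e)) (at x)"
      unfolding F_def
      by (intro has_derivative_diff has_derivative_scaleR_left has_derivative_mult_right)
        (auto intro!: derivative_eq_intros)
    also have "(\<lambda>h. h - (K / 2 * (2 * \<bar>f x\<bar> * (h \<bullet> e))) *\<^sub>R e) = blinfun_apply (F' x)"
      by (simp add: F'_def P blinfun.diff_left blinfun.scaleR_left fun_eq_iff)
    finally show ?thesis .
  qed
  have xs: "F xs = 0" "F' xs = id_blinfun" by (simp_all add: F_def F'_def f_def)
  have sym: "sym_part (F' xs) = id_blinfun"
    by (simp add: xs sym_part_self_adjoint adjoint_op_id)
  \<comment> \<open>The inverse of \<open>F' xs = id\<close> has norm at most one, so this bound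
    implies the scaled Lipschitz hypothesis.\<close>
  have lip: "norm (F' x - F' y) \<le> K * norm (x - y)" for x y
  proof -
    have "F' x - F' y = (K * (\<bar>f y\<bar> - \<bar>f x\<bar>)) *\<^sub>R P"
      by (simp add: F'_def algebra_simps)
    then have "norm (F' x - F' y) = K * \<bar>\<bar>f y\<bar> - \<bar>f x\<bar>\<bar> * norm P"
      using K by (simp add: abs_mult)
    also have "\<dots> \<le> K * \<bar>f x - f y\<bar> * 1"
      using K nP by (intro mult_mono) auto
    also have "\<dots> \<le> K * norm (x - y)"
      using Cauchy_Schwarz_ineq2[of "x - y" e] K e
      by (simp add: f_def inner_diff_left[symmetric])
    finally show ?thesis .
  qed
  have "newton_problem \<Omega> F F' (\<lambda>_. {0}) xs K"
    unfolding newton_problem_def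
  proof (intro conjI ballI)
    show "continuous_on \<Omega> F"
      by (meson continuous_at_imp_continuous_on deriv has_derivative_continuous)
    show "continuous_on \<Omega> F'"
      unfolding F'_def f_def by (intro continuous_intros)
    show "0 \<in> F xs +o {0}" by (simp add: zero_mem_elt_set_plus xs)
    show "positive_op (F' xs)" by (simp add: positive_op_def xs adjoint_op_id)
    show "invertible_op (sym_part (F' xs))"
      using is_inverse_op_id by (auto simp: sym invertible_op_def)
    fix x y
    have "norm (inverse_op (sym_part (F' xs))) * norm (F' x - F' y) \<le> 1 * norm (F' x - F' y)"
      unfolding sym inverse_op_eq[OF is_inverse_op_id]
      by (intro mult_right_mono norm_blinfun_id_le) simp
    then show "norm (inverse_op (sym_part (F' xs))) * norm (F' x - F' y) \<le> K * norm (x - y)"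
      using lip[of x y] by simp
  qed (use assms deriv maximal_monotone_op_zero in auto)
  moreover have "xs + s *\<^sub>R e \<in> ball xs \<rho> - {xs}" using s e by (auto simp: dist_norm)
  ultimately obtain x where x: "newton_sequence \<Omega> F F' (\<lambda>_. {0}) (xs + s *\<^sub>R e) x" "x \<longlonglongrightarrow> xs"
    using conv unfolding convergence_radius_def by blast
  \<comment> \<open>The residual of the linearized equation at the reflected point is
    \<open>a * (3 / 2 * (K * s) - 1)\<close> times \<open>e\<close>; it vanishes because
    \<open>K * s = 2 / 3\<close>.\<close>
  have step: "F (xs + a *\<^sub>R e) + blinfun_apply (F' (xs + a *\<^sub>R e)) (xs + (- a) *\<^sub>R e - (xs + a *\<^sub>R e)) = 0"
    if "\<bar>a\<bar> = s" for a
  proof -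
    have f: "f (xs + a *\<^sub>R e) = a" by (simp add: f_def ee)
    have F': "blinfun_apply (F' (xs + a *\<^sub>R e)) (c *\<^sub>R e) = (c - K * \<bar>a\<bar> * c) *\<^sub>R e" for c
      by (simp add: F'_def f P ee blinfun.diff_left blinfun.scaleR_left scaleR_diff_left)
    have F: "F (xs + a *\<^sub>R e) = (a - K / 2 * (a * \<bar>a\<bar>)) *\<^sub>R e"
      by (simp add: F_def f scaleR_diff_left)
    have "xs + (- a) *\<^sub>R e - (xs + a *\<^sub>R e) = (- a - a) *\<^sub>R e"
      unfolding scaleR_diff_left by simp
    then have "F (xs + a *\<^sub>R e) + blinfun_apply (F' (xs + a *\<^sub>R e)) (xs + (- a) *\<^sub>R e - (xs + a *\<^sub>R e))
        = (a - K / 2 * (a * \<bar>a\<bar>) + ((- a - a) - K * \<bar>a\<bar> * (- a - a))) *\<^sub>R e"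
      unfolding F by (simp only: F' scaleR_add_left)
    also have "a - K / 2 * (a * \<bar>a\<bar>) + ((- a - a) - K * \<bar>a\<bar> * (- a - a)) = a * (3 / 2 * (K * s) - 1)"
      by (simp add: that algebra_simps)
    finally show ?thesis by (simp add: s)
  qed
  have "\<exists>a. \<bar>a\<bar> = s \<and> x k = xs + a *\<^sub>R e" for k
  proof (induction k)
    case 0
    then show ?case using x(1) s by (intro exI[of _ s]) (simp add: newton_sequence_def)
  next
    case (Suc k)
    then obtain a where a: "\<bar>a\<bar> = s" "x k = xs + a *\<^sub>R e" by blast
    from x(1) have "- (F (x k) + blinfun_apply (F' (x k)) (y - x k)) \<in> {0} \<longleftrightarrow> y = x (Suc k)" for y
      unfolding newton_sequence_def zero_mem_elt_set_plus by blast
    \<comment> \<open>\<open>newton_sequence\<close> demands that the next iterate be the only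
      solution, so the reflected point is that iterate. The distance to \<open>xs\<close> therefore
      stays \<open>s\<close>, against convergence.\<close>
    then have "xs + (- a) *\<^sub>R e = x (Suc k)" using step[OF a(1)] unfolding a(2) by (metis minus_zero singletonI)
    then show ?case using a(1) by (intro exI[of _ "- a"]) simp
  qed
  then have "norm (x k - xs) = s" for k
    using e by (metis add_diff_cancel_left' mult.right_neutral norm_scaleR)
  moreover have "(\<lambda>k. norm (x k - xs)) \<longlonglongrightarrow> norm (xs - xs)" by (intro tendsto_intros x(2))
  ultimately show False using s(1) by (simp add: LIMSEQ_const_iff)
qed

theorem theorem12:
  fixes \<Omega> :: "'a::{real_inner,complete_space} set"
    and F :: "'a \<Rightarrow> 'a"
    and F' :: "'a \<Rightarrow> 'a \<Rightarrow>\<^sub>L 'a"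
    and T :: "'a \<Rightarrow> 'a set"
    and xs x0 :: 'a
    and K r \<sigma> :: real
    and t :: "nat \<Rightarrow> real"
  assumes "newton_problem \<Omega> F F' T xs K"
    and "r = newton_radius \<Omega> xs K"
    and "\<sigma> = min r (2 / K)"
    and "x0 \<in> ball xs r - {xs}"
    and "t = scalar_newton K (norm (xs - x0))"
  shows "(\<forall>k. 1 - K * t k \<noteq> 0) \<and>
    strict_antimono_on UNIV t \<and>
    range t \<subseteq> {0<..<r} \<and>
    t \<longlonglongrightarrow> 0 \<and>
    strict_antimono_on UNIV (\<lambda>k. t (Suc k) / (t k)\<^sup>2) \<and>
    (\<forall>k. t (Suc k) / (t k)\<^sup>2 \<le> 1 / (2 / K - 2 * norm (xs - x0))) \<and>
    (\<forall>k\<ge>1. t (Suc k) / (t k)\<^sup>2 < 1 / (2 / K - 2 * norm (xs - x0))) \<and>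
    (\<exists>x. newton_sequence \<Omega> F F' T x0 x \<and>
      range x \<subseteq> ball xs r \<and>
      x \<longlonglongrightarrow> xs \<and>
      (\<forall>k. norm (xs - x (Suc k)) \<le> K / 2 * (1 / (1 - K * t k)) * (norm (x k - xs))\<^sup>2 \<and>
           K / 2 * (1 / (1 - K * t k)) * (norm (x k - xs))\<^sup>2
             \<le> K / 2 * (1 / (1 - K * norm (x0 - xs))) * (norm (x k - xs))\<^sup>2)) \<and>
    {x \<in> ball xs \<sigma>. 0 \<in> F x +o T x} = {xs} \<and>
    (ereal (2 / (3 * K)) < ball_radius \<Omega> xs \<longrightarrow>
      r = 2 / (3 * K) \<and> best_convergence_radius \<Omega> xs K r)"
proof -
  have x0: "x0 \<in> ball xs (newton_radius \<Omega> xs K) - {xs}" using assms(2,4) by simp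
  interpret newton \<Omega> F F' T xs K
    using assms(1) x0 by unfold_locales blast+
  define \<tau> where "\<tau> = norm (xs - x0)"
  note start = start_bounds[OF x0, folded assms(2) \<tau>_def]
  note t_def = assms(5)[folded \<tau>_def]
  note t_bounds = scalar_newton_bounds[OF K_pos start(1,3), folded t_def]
  note Kt = scalar_newton_mult_less[OF K_pos start(1,3), folded t_def]
  note ratio = scalar_newton_ratio[OF K_pos start(1,3), folded t_def]
  note ratio_less = scalar_newton_ratio_less[OF K_pos start(1,3), folded t_def]
  have t_0: "t 0 = \<tau>" by (simp add: t_def)
  have Suc_less: "t (Suc k) < t k" for k by (rule t_bounds(4))
  have t_in: "t k \<in> {0<..<r}" for k
    using t_bounds(1,3)[of k] start(2) by auto
  \<comment> \<open>At \<open>k = 0\<close> the ratio equals the bound, since \<open>t 0\<close> is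
    the initial distance. The strict inequality therefore starts at \<open>k = 1\<close>, and only
    the weak one holds for all \<open>k\<close>.\<close>
  have first: "t (Suc 0) / (t 0)\<^sup>2 = 1 / (2 / K - 2 * \<tau>)"
    unfolding ratio[of 0] unfolding t_0
    using K_pos Kt[of 0, unfolded t_0] by (simp add: field_simps)
  have later: "t (Suc k) / (t k)\<^sup>2 < 1 / (2 / K - 2 * \<tau>)" if "1 \<le> k" for k
  proof -
    have "t k < t 0"
      using strict_antimono_SucI[of t, OF Suc_less] that unfolding monotone_on_def by auto
    from ratio_less[OF this] show ?thesis unfolding first .
  qed
  have all: "t (Suc k) / (t k)\<^sup>2 \<le> 1 / (2 / K - 2 * \<tau>)" for k
    using first later[of k] by (cases k) auto
  obtain x where x: "newton_sequence \<Omega> F F' T x0 x" "range x \<subseteq> ball xs r" "x \<longlonglongrightarrow> xs"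
    "\<And>k. norm (xs - x (Suc k)) \<le> K / 2 * (1 / (1 - K * t k)) * (norm (x k - xs))\<^sup>2"
    using newton_sequence_exists[OF x0] unfolding assms(2,5) by metis
  have mono: "K / 2 * (1 / (1 - K * t k)) * (norm (x k - xs))\<^sup>2
      \<le> K / 2 * (1 / (1 - K * norm (x0 - xs))) * (norm (x k - xs))\<^sup>2" for k
  proof -
    have "1 / (1 - K * t k) \<le> 1 / (1 - K * \<tau>)"
      using Kt[of k] Kt[of 0, unfolded t_0] t_bounds(3)[of k] K_pos
      by (intro divide_left_mono diff_left_mono mult_left_mono mult_pos_pos) auto
    then show ?thesis
      using K_pos unfolding \<tau>_def norm_minus_commute[of xs x0]
      by (intro mult_right_mono mult_left_mono) auto
  qed
  have "2 / (3 * K) \<le> 2 / K" using K_pos by (intro divide_left_mono) auto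
  then have \<sigma>: "\<sigma> = newton_radius \<Omega> xs K" using radius(2) unfolding assms(2,3) by simp
  have unique: "{x \<in> ball xs \<sigma>. 0 \<in> F x +o T x} = {xs}"
    using solution_unique xs_ball xs_solution unfolding \<sigma> zero_mem_elt_set_plus by blast
  have best: "r = 2 / (3 * K) \<and> best_convergence_radius \<Omega> xs K r"
    if less: "ereal (2 / (3 * K)) < ball_radius \<Omega> xs"
  proof
    show r: "r = 2 / (3 * K)" using radius(4)[OF less] assms(2) by simp
    \<comment> \<open>The starting point \<open>x0\<close>, being different from \<open>xs\<close>,
      supplies the direction of the cycle.\<close>
    have "\<rho> \<le> r" if "convergence_radius \<Omega> xs K \<rho>" for \<rho>
      unfolding r using x0
      by (intro convergence_radius_le[OF open_dom xs_mem K_pos _ _ that, of x0]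
          ball_subset_of_less_ball_radius less) blast
    then show "best_convergence_radius \<Omega> xs K r"
      unfolding best_convergence_radius_def
      using convergence_radius_newton_radius[of \<Omega> xs K] assms(2) by simp
  qed
  have nonzero: "1 - K * t k \<noteq> 0" for k using Kt[of k] by simp
  have lim: "t \<longlonglongrightarrow> 0"
    unfolding t_def by (rule scalar_newton_tendsto[OF K_pos start(1,3)])
  show ?thesis
    unfolding \<tau>_def[symmetric]
  proof (intro conjI exI[of _ x])
    show "\<forall>k. 1 - K * t k \<noteq> 0" using nonzero by blast
    show "strict_antimono_on UNIV t" by (rule strict_antimono_SucI) (rule Suc_less)
    show "range t \<subseteq> {0<..<r}" using t_in by blast
    show "t \<longlonglongrightarrow> 0" by (rule lim)
    show "strict_antimono_on UNIV (\<lambda>k. t (Suc k) / (t k)\<^sup>2)"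
      by (rule strict_antimono_SucI) (rule ratio_less[OF Suc_less])
    show "\<forall>k. t (Suc k) / (t k)\<^sup>2 \<le> 1 / (2 / K - 2 * \<tau>)" using all by blast
    show "\<forall>k\<ge>1. t (Suc k) / (t k)\<^sup>2 < 1 / (2 / K - 2 * \<tau>)" using later by blast
    show "ereal (2 / (3 * K)) < ball_radius \<Omega> xs \<longrightarrow>
        r = 2 / (3 * K) \<and> best_convergence_radius \<Omega> xs K r"
      by (rule impI) (rule best)
    show "\<forall>k. norm (xs - x (Suc k)) \<le> K / 2 * (1 / (1 - K * t k)) * (norm (x k - xs))\<^sup>2 \<and>
        K / 2 * (1 / (1 - K * t k)) * (norm (x k - xs))\<^sup>2
          \<le> K / 2 * (1 / (1 - K * norm (x0 - xs))) * (norm (x k - xs))\<^sup>2"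
      by (intro allI conjI x(4) mono)
  qed (fact x unique)+
qed

end
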